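(* Let $\sigma_1,\sigma_2$ be weight functions on $T$, let $\varphi:T\to T$ be a self map and $\psi:T\to\mathbb{C}$ a function, and let $W_{\psi,\varphi}(f)=\psi\,(f\circ\varphi)$. The operator $W_{\psi,\varphi}:\mathbb{T}_{\sigma_1,\infty}\to\mathbb{T}_{\sigma_2,\infty}$ is compact if and only if $$\sup_{x\in\varphi^{-1}(y)}\left|\frac{\sigma_2(x)\psi(x)}{\sigma_1(\varphi(x))}\right|\to0\quad\text{as } |y|\to\infty.$$
   Context: $T$ is an infinite rooted tree, identified with its vertex set; $|x|$ is the edge-counting distance from the root $o$ to the vertex $x$; $c_n$ is the number of vertices $x$ with $|x|=n$, $n\in\mathbb{N}_0=\{0,1,2,\dots\}$. Standing assumptions: every $c_n$ is finite and the sequence $\{c_n\}$ is unbounded. A weight function is a function $\sigma:T\to(0,\infty)$. For a weight $\sigma$ and $f:T\to\mathbb{C}$, put $\|f\|_{\sigma,\infty}=\sup_{x\in T}\sigma(x)|f(x)|$; $\mathbb{T}_{\sigma,\infty}$ is the set of all $f:T\to\mathbb{C}$ with $\|f\|_{\sigma,\infty}<\infty$. That a linear operator $A:X\to Y$ is compact means that $Af\in Y$ for every $f\in X$ and that for every bounded sequence $(f_n)$ in $X$ the sequence $(Af_n)$ has a subsequence converging in norm in $Y$. Convention: the supremum of the absolute value of a function over the empty set is $0$.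
   Formalization: The criterion also requires the supremum over each fiber φ^{-1}(y) to be finite; without this it fails, e.g. φ constantly o, both weights 1, ψ unbounded: the limit is 0 but the operator does not map into the target space. *)

theory Defs
  imports "HOL-Analysis.Analysis"
begin

text \<open>Simple undirected graphs are given by an adjacency relation on a type of vertices.\<close>

definition graph_cycle :: "('v \<Rightarrow> 'v \<Rightarrow> bool) \<Rightarrow> 'v list \<Rightarrow> bool" where
  "graph_cycle E xs \<longleftrightarrow>
     3 \<le> length xs \<and> distinct xs \<and> successively E xs \<and> E (last xs) (hd xs)"

definition is_tree :: "('v \<Rightarrow> 'v \<Rightarrow> bool) \<Rightarrow> bool" where
  "is_tree E \<longleftrightarrow>
     symp E \<and> irreflp E \<and> (\<forall>x y. E\<^sup>*\<^sup>* x y) \<and> (\<nexists>xs. graph_cycle E xs)"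

definition edge_dist :: "('v \<Rightarrow> 'v \<Rightarrow> bool) \<Rightarrow> 'v \<Rightarrow> 'v \<Rightarrow> nat" where
  "edge_dist E x y = (LEAST n. (E ^^ n) x y)"

definition level :: "('v \<Rightarrow> 'v \<Rightarrow> bool) \<Rightarrow> 'v \<Rightarrow> nat \<Rightarrow> 'v set" where
  "level E \<rho> n = {x. edge_dist E \<rho> x = n}"

definition at_infinity_from :: "('v \<Rightarrow> 'v \<Rightarrow> bool) \<Rightarrow> 'v \<Rightarrow> 'v filter" where
  "at_infinity_from E \<rho> = filtercomap (edge_dist E \<rho>) at_top"

locale infinite_rooted_tree =
  fixes E :: "'v \<Rightarrow> 'v \<Rightarrow> bool" and \<rho> :: 'v
  assumes tree: "is_tree E"
    and infinite_vertices: "infinite (UNIV :: 'v set)"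
    and finite_level: "finite (level E \<rho> n)"
    and unbounded_levels: "\<not> bdd_above (range (\<lambda>n. card (level E \<rho> n)))"

definition weight :: "('v \<Rightarrow> real) \<Rightarrow> bool" where
  "weight \<sigma> \<longleftrightarrow> (\<forall>x. 0 < \<sigma> x)"

text \<open>Suprema of absolute values are taken in \<^typ>\<open>ennreal\<close>: there they always exist,
  may be infinite, and equal \<open>0\<close> over the empty set.\<close>

definition wnorm :: "('v \<Rightarrow> real) \<Rightarrow> ('v \<Rightarrow> complex) \<Rightarrow> ennreal" where
  "wnorm \<sigma> f = (SUP x. ennreal (\<sigma> x * cmod (f x)))"

definition wspace :: "('v \<Rightarrow> real) \<Rightarrow> ('v \<Rightarrow> complex) set" where
  "wspace \<sigma> = {f. wnorm \<sigma> f < \<infinity>}"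

definition compact_operator ::
  "('v \<Rightarrow> real) \<Rightarrow> ('v \<Rightarrow> real) \<Rightarrow> (('v \<Rightarrow> complex) \<Rightarrow> ('v \<Rightarrow> complex)) \<Rightarrow> bool" where
  "compact_operator \<sigma>1 \<sigma>2 A \<longleftrightarrow>
     (\<forall>f\<in>wspace \<sigma>1. A f \<in> wspace \<sigma>2) \<and>
     (\<forall>F. (\<forall>n. F n \<in> wspace \<sigma>1) \<and> (\<exists>M::real. \<forall>n. wnorm \<sigma>1 (F n) \<le> ennreal M) \<longrightarrow>
        (\<exists>g\<in>wspace \<sigma>2. \<exists>r. strict_mono (r :: nat \<Rightarrow> nat) \<and>
           (\<lambda>k. wnorm \<sigma>2 (\<lambda>x. A (F (r k)) x - g x)) \<longlonglongrightarrow> 0))"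

definition weighted_comp ::
  "('v \<Rightarrow> complex) \<Rightarrow> ('v \<Rightarrow> 'v) \<Rightarrow> ('v \<Rightarrow> complex) \<Rightarrow> ('v \<Rightarrow> complex)" where
  "weighted_comp \<psi> \<phi> f = (\<lambda>x. \<psi> x * f (\<phi> x))"

definition fiber_sup ::
  "('v \<Rightarrow> real) \<Rightarrow> ('v \<Rightarrow> real) \<Rightarrow> ('v \<Rightarrow> complex) \<Rightarrow> ('v \<Rightarrow> 'v) \<Rightarrow> 'v \<Rightarrow> ennreal" where
  "fiber_sup \<sigma>1 \<sigma>2 \<psi> \<phi> y =
     (SUP x\<in>\<phi> -` {y}. ennreal (cmod (of_real (\<sigma>2 x) * \<psi> x / of_real (\<sigma>1 (\<phi> x)))))"

text \<open>A fiber of \<open>\<phi>\<close> may be infinite, so a single fiber supremum can be infinite even when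
  the limit at infinity is \<open>0\<close>. This cannot happen if the weighted composition operator maps
  the first space into the second.\<close>

lemma fiber_sup_finite:
  assumes "weight \<sigma>1" "weight \<sigma>2"
    and maps: "\<forall>f\<in>wspace \<sigma>1. weighted_comp \<psi> \<phi> f \<in> wspace \<sigma>2"
  shows "fiber_sup \<sigma>1 \<sigma>2 \<psi> \<phi> y < \<infinity>"
proof -
  define f where "f = (\<lambda>x. complex_of_real (1 / \<sigma>1 x))"
  have pos: "0 < \<sigma>1 x" "0 < \<sigma>2 x" for x
    using assms by (auto simp: weight_def)
  have "\<sigma>1 x * cmod (f x) = 1" for x
    using pos(1)[of x] by (simp add: f_def norm_divide)
  then have "wnorm \<sigma>1 f = 1"
    by (simp add: wnorm_def)
  then have "f \<in> wspace \<sigma>1"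
    by (simp add: wspace_def)
  with maps have fin: "wnorm \<sigma>2 (weighted_comp \<psi> \<phi> f) < \<infinity>"
    by (auto simp: wspace_def)
  have eq: "cmod (of_real (\<sigma>2 x) * \<psi> x / of_real (\<sigma>1 (\<phi> x)))
      = \<sigma>2 x * cmod (weighted_comp \<psi> \<phi> f x)" for x
    using pos(1)[of "\<phi> x"] pos(2)[of x]
    by (simp add: weighted_comp_def f_def norm_mult norm_divide)
  have "fiber_sup \<sigma>1 \<sigma>2 \<psi> \<phi> y \<le> wnorm \<sigma>2 (weighted_comp \<psi> \<phi> f)"
    unfolding fiber_sup_def wnorm_def eq by (rule SUP_subset_mono) auto
  with fin show ?thesis by (rule le_less_trans[rotated])
qed

end

theory Submission
  imports Defs "HOL-Complex_Analysis.Great_Picard"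
begin

text \<open>With \<open>q x = \<sigma>2 x * \<bar>\<psi> x\<bar> / \<sigma>1 (\<phi> x)\<close>, one has
  \<open>\<sigma>2 x * \<bar>(W f) x\<bar> = q x * (\<sigma>1 (\<phi> x) * \<bar>f (\<phi> x)\<bar>)\<close>. Since the levels are finite, tending to
  infinity in the tree is the cofinite filter. If the fiber suprema do not tend to \<open>0\<close>, the
  normalised point masses at infinitely many bad vertices are a bounded sequence whose images are
  carried by disjoint fibers and have norms bounded below. Conversely, a bounded sequence has a
  pointwise convergent subsequence; its images converge uniformly because \<open>q\<close> is small outside
  finitely many fibers, and on these only finitely many values of the functions matter.\<close>

section \<open>Weighted supremum norms and real bounds\<close>

lemma wnorm_upper: "ennreal (\<sigma> x * cmod (f x)) \<le> wnorm \<sigma> f"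
  unfolding wnorm_def by (rule SUP_upper) simp

text \<open>The sign condition matters because \<open>ennreal\<close> sends every negative real to
  0.\<close>

lemma wnorm_le_ennreal_iff:
  assumes "0 \<le> M"
  shows "wnorm \<sigma> f \<le> ennreal M \<longleftrightarrow> (\<forall>x. \<sigma> x * cmod (f x) \<le> M)"
  using assms by (simp add: wnorm_def SUP_le_iff ennreal_le_iff)

lemma wspace_boundE:
  assumes "f \<in> wspace \<sigma>"
  obtains M where "0 \<le> M" "wnorm \<sigma> f \<le> ennreal M"
  using assms unfolding wspace_def
  by (cases "wnorm \<sigma> f") auto

lemma wspaceI:
  assumes "0 \<le> M" "\<And>x. \<sigma> x * cmod (f x) \<le> M"
  shows "f \<in> wspace \<sigma>"
  using wnorm_le_ennreal_iff[OF assms(1), of \<sigma> f] assms(2)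
  by (auto simp: wspace_def intro: le_less_trans)

section \<open>Countability of the tree and its filter at infinity\<close>

context infinite_rooted_tree
begin

text \<open>This supplies the countability for the diagonal extraction of a pointwise convergent
  subsequence.\<close>

lemma countable_vertices: "countable (UNIV :: 'v set)"
proof -
  have "UNIV = (\<Union>n. level E \<rho> n)"
    by (auto simp: level_def)
  also have "countable \<dots>"
    using finite_level by (intro countable_UN) (auto intro: countable_finite)
  finally show ?thesis .
qed

text \<open>Below any height there are only finitely many vertices, since each level is finite;
  conversely, the distances from the root are bounded on a finite set.\<close>

lemma at_infinity_from_eq_cofinite: "at_infinity_from E \<rho> = cofinite"
proof (rule filter_eqI)
  fix P :: "'v \<Rightarrow> bool"
  have "(\<exists>N. \<forall>x. N \<le> edge_dist E \<rho> x \<longrightarrow> P x) \<longleftrightarrow> finite {x. \<not> P x}"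
  proof
    assume "\<exists>N. \<forall>x. N \<le> edge_dist E \<rho> x \<longrightarrow> P x"
    then obtain N where "\<And>x. N \<le> edge_dist E \<rho> x \<Longrightarrow> P x" by blast
    then have "{x. \<not> P x} \<subseteq> (\<Union>n<N. level E \<rho> n)"
      by (force simp: level_def not_le[symmetric])
    moreover have "finite (\<Union>n<N. level E \<rho> n)"
      using finite_level by blast
    ultimately show "finite {x. \<not> P x}"
      by (rule finite_subset)
  next
    assume "finite {x. \<not> P x}"
    then have "finite (edge_dist E \<rho> ` {x. \<not> P x})" by simp
    then obtain N where "\<And>x. \<not> P x \<Longrightarrow> edge_dist E \<rho> x < N"
      unfolding finite_nat_set_iff_bounded by blast
    then show "\<exists>N. \<forall>x. N \<le> edge_dist E \<rho> x \<longrightarrow> P x"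
      by (meson not_le)
  qed
  then show "eventually P (at_infinity_from E \<rho>) \<longleftrightarrow> eventually P cofinite"
    unfolding at_infinity_from_def eventually_filtercomap eventually_cofinite
      eventually_at_top_linorder
    by metis
qed

end

section \<open>The multiplier and its suprema over fibers\<close>

definition multiplier ::
  "('v \<Rightarrow> real) \<Rightarrow> ('v \<Rightarrow> real) \<Rightarrow> ('v \<Rightarrow> complex) \<Rightarrow> ('v \<Rightarrow> 'v) \<Rightarrow> 'v \<Rightarrow> real" where
  "multiplier \<sigma>1 \<sigma>2 \<psi> \<phi> x = \<sigma>2 x * cmod (\<psi> x) / \<sigma>1 (\<phi> x)"

context
  fixes \<sigma>1 \<sigma>2 :: "'v \<Rightarrow> real" and \<phi> :: "'v \<Rightarrow> 'v" and \<psi> :: "'v \<Rightarrow> complex"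
  assumes weight1: "weight \<sigma>1" and weight2: "weight \<sigma>2"
begin

abbreviation "q \<equiv> multiplier \<sigma>1 \<sigma>2 \<psi> \<phi>"

lemma weight_pos: "0 < \<sigma>1 x" "0 < \<sigma>2 x"
  using weight1 weight2 by (auto simp: weight_def)

lemma multiplier_nonneg: "0 \<le> q x"
  using weight_pos[of x] weight_pos[of "\<phi> x"] by (simp add: multiplier_def)

lemma fiber_sup_eq_multiplier: "fiber_sup \<sigma>1 \<sigma>2 \<psi> \<phi> y = (SUP x\<in>\<phi> -` {y}. ennreal (q x))"
  using weight_pos by (simp add: fiber_sup_def multiplier_def norm_mult norm_divide less_imp_le)

lemma multiplier_le_fiber_sup: "ennreal (q x) \<le> fiber_sup \<sigma>1 \<sigma>2 \<psi> \<phi> (\<phi> x)"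
  unfolding fiber_sup_eq_multiplier by (rule SUP_upper) simp

lemma weighted_comp_multiplier:
  "\<sigma>2 x * cmod (weighted_comp \<psi> \<phi> f x) = q x * (\<sigma>1 (\<phi> x) * cmod (f (\<phi> x)))"
  using weight_pos(1)[of "\<phi> x"] by (simp add: multiplier_def weighted_comp_def norm_mult)

section \<open>Compactness forces decay of the fiber suprema\<close>

lemma compact_imp_fiber_sup_tendsto:
  assumes "compact_operator \<sigma>1 \<sigma>2 (weighted_comp \<psi> \<phi>)"
  shows "(fiber_sup \<sigma>1 \<sigma>2 \<psi> \<phi> \<longlongrightarrow> 0) cofinite"
proof (rule order_tendstoI)
  fix e :: ennreal assume "0 < e"
  show "\<forall>\<^sub>F y in cofinite. fiber_sup \<sigma>1 \<sigma>2 \<psi> \<phi> y < e"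
  proof (rule ccontr)
    assume "\<not> ?thesis"
    then have "infinite {y. e \<le> fiber_sup \<sigma>1 \<sigma>2 \<psi> \<phi> y}"
      by (simp add: eventually_cofinite not_less)
    from infinite_countable_subset[OF this] obtain Y :: "nat \<Rightarrow> 'v"
      where inj: "inj Y" and "range Y \<subseteq> {y. e \<le> fiber_sup \<sigma>1 \<sigma>2 \<psi> \<phi> y}"
      by blast
    then have Y: "e \<le> fiber_sup \<sigma>1 \<sigma>2 \<psi> \<phi> (Y n)" for n
      by auto
    \<comment> \<open>As \<open>e\<close> may be infinite, it is replaced by a real \<open>d\<close>
      strictly below it. The strict gap also yields a point with \<open>d < q x\<close> later,
      although a fiber supremum need not be attained.\<close>
    obtain z where z: "0 < z" "z < e" using dense[OF \<open>0 < e\<close>] by blast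
    then obtain d where d: "0 < d" "ennreal d < e"
      by (cases z) auto
    define F where "F n y = (if y = Y n then complex_of_real (1 / \<sigma>1 y) else 0)" for n y
    have F_abs: "\<sigma>1 y * cmod (F n y) = (if y = Y n then 1 else 0)" for n y
      using weight_pos(1)[of y] by (auto simp: F_def norm_divide)
    have "F n \<in> wspace \<sigma>1" for n
      by (rule wspaceI[of 1]) (auto simp: F_abs)
    moreover have "wnorm \<sigma>1 (F n) \<le> ennreal 1" for n
      by (subst wnorm_le_ennreal_iff) (auto simp: F_abs)
    ultimately obtain g r where r: "strict_mono (r :: nat \<Rightarrow> nat)"
      and lim: "(\<lambda>k. wnorm \<sigma>2 (\<lambda>x. weighted_comp \<psi> \<phi> (F (r k)) x - g x)) \<longlonglongrightarrow> 0"
      using assms unfolding compact_operator_def by blast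
    have "\<forall>\<^sub>F k in sequentially.
        wnorm \<sigma>2 (\<lambda>x. weighted_comp \<psi> \<phi> (F (r k)) x - g x) < ennreal (d / 2)"
      using d by (intro order_tendstoD(2)[OF lim]) simp
    then obtain k where k: "\<And>j. k \<le> j \<Longrightarrow>
        wnorm \<sigma>2 (\<lambda>x. weighted_comp \<psi> \<phi> (F (r j)) x - g x) < ennreal (d / 2)"
      unfolding eventually_sequentially by blast
    have close: "\<sigma>2 x * cmod (weighted_comp \<psi> \<phi> (F (r j)) x - g x) < d / 2" if "k \<le> j" for j x
      using le_less_trans[OF wnorm_upper k[OF that], of x] d by (simp add: ennreal_less_iff weight_pos less_imp_le)
    have "ennreal d < fiber_sup \<sigma>1 \<sigma>2 \<psi> \<phi> (Y (r k))"
      using d(2) Y by (rule less_le_trans)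
    then obtain x where x: "\<phi> x = Y (r k)" "d < q x"
      unfolding fiber_sup_eq_multiplier less_SUP_iff using d(1) by (auto simp: ennreal_less_iff)
    \<comment> \<open>The limit \<open>g\<close> is within \<open>d / 2\<close> of two images. At
      \<open>x\<close> the later one vanishes, so \<open>g\<close> is small there; the earlier one
      has weighted modulus \<open>q x\<close>, which is then below \<open>d\<close>.\<close>
    have "r k \<noteq> r (Suc k)"
      using strict_monoD[OF r, of k "Suc k"] by simp
    then have "weighted_comp \<psi> \<phi> (F (r (Suc k))) x = 0"
      using inj x(1) by (simp add: weighted_comp_def F_def inj_eq)
    then have g: "\<sigma>2 x * cmod (g x) < d / 2"
      using close[of "Suc k" x] by simp
    have "q x = \<sigma>2 x * cmod (weighted_comp \<psi> \<phi> (F (r k)) x)"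
      by (simp add: weighted_comp_multiplier F_abs x(1))
    also have "\<dots> \<le> \<sigma>2 x * (cmod (weighted_comp \<psi> \<phi> (F (r k)) x - g x) + cmod (g x))"
      using weight_pos(2)[of x] norm_triangle_sub[of "weighted_comp \<psi> \<phi> (F (r k)) x" "g x"]
      by (intro mult_left_mono) auto
    also have "\<dots> < d"
      using close[of k x] g by (simp add: distrib_left)
    finally show False using x(2) by simp
  qed
qed simp

section \<open>Decay of finite fiber suprema gives compactness\<close>

text \<open>The limit bounds \<open>q\<close> by 1 off finitely many fibers, and \<open>fin\<close>
  bounds it on each of the remaining ones.\<close>

lemma multiplier_bounded:
  assumes fin: "\<And>y. fiber_sup \<sigma>1 \<sigma>2 \<psi> \<phi> y < \<infinity>"
    and lim: "(fiber_sup \<sigma>1 \<sigma>2 \<psi> \<phi> \<longlongrightarrow> 0) cofinite"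
  obtains C where "0 \<le> C" "\<And>x. q x \<le> C"
proof -
  let ?s = "fiber_sup \<sigma>1 \<sigma>2 \<psi> \<phi>"
  have "\<forall>\<^sub>F y in cofinite. ?s y < 1"
    by (rule order_tendstoD(2)[OF lim]) simp
  then have S: "finite {y. \<not> ?s y < 1}"
    by (simp add: eventually_cofinite)
  \<comment> \<open>A sum of nonnegative terms dominates each of them and, unlike a maximum, makes
    sense when there is no exceptional vertex.\<close>
  define C where "C = 1 + (\<Sum>y | \<not> ?s y < 1. enn2real (?s y))"
  have "q x \<le> C" for x
  proof (cases "?s (\<phi> x) < 1")
    case True
    with multiplier_le_fiber_sup[of x] have "ennreal (q x) < ennreal 1"
      unfolding ennreal_1 by (rule le_less_trans)
    then have "q x \<le> 1"
      by (simp add: ennreal_less_iff multiplier_nonneg)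
    also have "\<dots> \<le> C" by (simp add: C_def sum_nonneg)
    finally show ?thesis .
  next
    case False
    have "q x = enn2real (ennreal (q x))"
      by (simp add: multiplier_nonneg)
    \<comment> \<open>Finiteness is essential here: \<open>enn2real\<close> sends infinity to
      0.\<close>
    also have "\<dots> \<le> enn2real (?s (\<phi> x))"
      using fin multiplier_le_fiber_sup by (intro enn2real_mono) auto
    also have "\<dots> \<le> (\<Sum>y | \<not> ?s y < 1. enn2real (?s y))"
      using S False by (intro member_le_sum) auto
    also have "\<dots> \<le> C" by (simp add: C_def)
    finally show ?thesis .
  qed
  moreover have "0 \<le> C" by (simp add: C_def sum_nonneg)
  ultimately show thesis using that by blast
qed

lemma weighted_comp_le:
  assumes "\<And>x. q x \<le> C" "\<And>x. \<sigma>1 x * cmod (f x) \<le> M"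
  shows "\<sigma>2 x * cmod (weighted_comp \<psi> \<phi> f x) \<le> C * M"
  unfolding weighted_comp_multiplier
  using assms multiplier_nonneg[of x] weight_pos(1)[of "\<phi> x"]
    order_trans[OF multiplier_nonneg assms(1)]
  by (intro mult_mono) auto

lemma weighted_comp_in_wspace:
  assumes "\<And>x. q x \<le> C" "f \<in> wspace \<sigma>1"
  shows "weighted_comp \<psi> \<phi> f \<in> wspace \<sigma>2"
proof -
  obtain M where "0 \<le> M" "wnorm \<sigma>1 f \<le> ennreal M"
    using assms(2) by (rule wspace_boundE)
  moreover have "0 \<le> C"
    using order_trans[OF multiplier_nonneg assms(1)] .
  ultimately show ?thesis
    using weighted_comp_le[OF assms(1), of f M]
    by (intro wspaceI[of "C * M"]) (auto simp: wnorm_le_ennreal_iff)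
qed

text \<open>In the product \<open>q x * (\<sigma>1 (\<phi> x) * cmod (h n (\<phi> x)))\<close> one
  factor is always small and the other bounded: \<open>q\<close> is small off finitely many fibers,
  the weighted value of \<open>h n\<close> on them.\<close>

lemma weighted_comp_wnorm_tendsto:
  assumes C: "\<And>x. q x \<le> C"
    and lim: "(fiber_sup \<sigma>1 \<sigma>2 \<psi> \<phi> \<longlongrightarrow> 0) cofinite"
    and M: "\<And>n x. \<sigma>1 x * cmod (h n x) \<le> M"
    and ptw: "\<And>x. (\<lambda>n. \<sigma>1 x * cmod (h n x)) \<longlonglongrightarrow> 0"
  shows "(\<lambda>n. wnorm \<sigma>2 (weighted_comp \<psi> \<phi> (h n))) \<longlonglongrightarrow> 0"
proof (rule order_tendstoI)
  fix e :: ennreal assume "0 < e"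
  then obtain z where z: "0 < z" "z < e" using dense by blast
  then obtain d where d: "0 < d" "ennreal d < e"
    by (cases z) auto
  have C0: "0 \<le> C"
    using order_trans[OF multiplier_nonneg C] .
  have M0: "0 \<le> M"
    using order_trans[OF _ M] weight_pos by (simp add: less_imp_le)
  let ?s = "fiber_sup \<sigma>1 \<sigma>2 \<psi> \<phi>"
  \<comment> \<open>Adding 1 to the denominators gives \<open>\<delta> * M \<le> d\<close> and
    \<open>C * \<eta> \<le> d\<close> even if \<open>M\<close> or \<open>C\<close> is 0.\<close>
  define \<delta> where "\<delta> = d / (M + 1)"
  define \<eta> where "\<eta> = d / (C + 1)"
  have pos: "0 < \<delta>" "0 < \<eta>" using d C0 M0 by (auto simp: \<delta>_def \<eta>_def)
  have "\<forall>\<^sub>F y in cofinite. ?s y < ennreal \<delta>"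
    using pos by (intro order_tendstoD(2)[OF lim]) simp
  then have S: "finite {y. \<not> ?s y < ennreal \<delta>}"
    by (simp add: eventually_cofinite)
  \<comment> \<open>Pointwise convergence is uniform on a finite set. The set consists of values of
    \<open>\<phi>\<close> rather than arguments, so infinite fibers do no harm.\<close>
  have "\<forall>\<^sub>F n in sequentially. \<forall>y\<in>{y. \<not> ?s y < ennreal \<delta>}. \<sigma>1 y * cmod (h n y) < \<eta>"
    using S pos by (intro eventually_ball_finite ballI order_tendstoD(2)[OF ptw]) auto
  then show "\<forall>\<^sub>F n in sequentially. wnorm \<sigma>2 (weighted_comp \<psi> \<phi> (h n)) < e"
  proof eventually_elim
    case (elim n)
    have "\<sigma>2 x * cmod (weighted_comp \<psi> \<phi> (h n) x) \<le> d" for x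
    proof (cases "?s (\<phi> x) < ennreal \<delta>")
      case True
      then have "ennreal (q x) < ennreal \<delta>"
        by (rule le_less_trans[OF multiplier_le_fiber_sup])
      then have "q x \<le> \<delta>"
        by (simp add: ennreal_less_iff multiplier_nonneg)
      then have "q x * (\<sigma>1 (\<phi> x) * cmod (h n (\<phi> x))) \<le> \<delta> * M"
        using M weight_pos(1)[of "\<phi> x"] pos by (intro mult_mono) auto
      also have "\<dots> \<le> d"
        using d M0 by (simp add: \<delta>_def field_simps)
      finally show ?thesis by (simp only: weighted_comp_multiplier)
    next
      case False
      then have "q x * (\<sigma>1 (\<phi> x) * cmod (h n (\<phi> x))) \<le> C * \<eta>"
        using elim C C0 weight_pos(1)[of "\<phi> x"] by (intro mult_mono) (auto simp: less_imp_le)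
      also have "\<dots> \<le> d"
        using d C0 by (simp add: \<eta>_def field_simps)
      finally show ?thesis by (simp only: weighted_comp_multiplier)
    qed
    then have "wnorm \<sigma>2 (weighted_comp \<psi> \<phi> (h n)) \<le> ennreal d"
      using d by (simp add: wnorm_le_ennreal_iff)
    also note d(2)
    finally show ?case .
  qed
qed simp

text \<open>The diagonal argument is applied to the functions multiplied by
  \<open>\<sigma>1\<close>: these share the bound \<open>M\<close> at all vertices, whereas
  \<open>F n x\<close> itself is only bounded by \<open>M / \<sigma>1 x\<close>. Dividing the limits
  by \<open>\<sigma>1\<close> gives \<open>f\<close>.\<close>

lemma bounded_pointwise_convergent_subsequence:
  assumes "countable (UNIV :: 'v set)"
    and M: "\<And>n x. \<sigma>1 x * cmod (F n x) \<le> M"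
  obtains r f where "strict_mono (r :: nat \<Rightarrow> nat)" "\<And>x. \<sigma>1 x * cmod (f x) \<le> M"
    "\<And>x. (\<lambda>n. F (r n) x) \<longlonglongrightarrow> f x"
proof -
  have "cmod (complex_of_real (\<sigma>1 x) * F n x) \<le> M" for n x
    using M[of x n] weight_pos(1)[of x] by (simp add: norm_mult)
  then obtain r where r: "strict_mono (r :: nat \<Rightarrow> nat)"
    and "\<And>x. \<exists>l. (\<lambda>n. complex_of_real (\<sigma>1 x) * F (r n) x) \<longlonglongrightarrow> l"
    using function_convergent_subsequence[OF assms(1),
        of "\<lambda>n x. complex_of_real (\<sigma>1 x) * F n x" M]
    by (metis UNIV_I)
  then obtain l where l: "\<And>x. (\<lambda>n. complex_of_real (\<sigma>1 x) * F (r n) x) \<longlonglongrightarrow> l x"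
    by metis
  have lim: "(\<lambda>n. F (r n) x) \<longlonglongrightarrow> l x / complex_of_real (\<sigma>1 x)" for x
    using tendsto_divide[OF l tendsto_const, of "complex_of_real (\<sigma>1 x)" x] weight_pos(1)[of x]
    by simp
  have "\<sigma>1 x * cmod (l x / complex_of_real (\<sigma>1 x)) \<le> M" for x
    using M by (intro Lim_bounded[OF tendsto_mult[OF tendsto_const tendsto_norm[OF lim]]]) auto
  from that[OF r this lim] show thesis .
qed

text \<open>The limit of the images is the image of the pointwise limit \<open>f\<close>. By
  linearity it suffices to treat the differences \<open>F (r n) - f\<close>, which have the uniform
  bound \<open>2 * M\<close> and tend to 0 pointwise.\<close>

lemma fiber_sup_tendsto_imp_compact:
  assumes countable: "countable (UNIV :: 'v set)"
    and fin: "\<And>y. fiber_sup \<sigma>1 \<sigma>2 \<psi> \<phi> y < \<infinity>"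
    and lim: "(fiber_sup \<sigma>1 \<sigma>2 \<psi> \<phi> \<longlongrightarrow> 0) cofinite"
  shows "compact_operator \<sigma>1 \<sigma>2 (weighted_comp \<psi> \<phi>)"
proof -
  obtain C where C: "\<And>x. q x \<le> C"
    using multiplier_bounded[OF fin lim] by blast
  have subseq: "\<exists>g\<in>wspace \<sigma>2. \<exists>r. strict_mono (r :: nat \<Rightarrow> nat) \<and>
      (\<lambda>k. wnorm \<sigma>2 (\<lambda>x. weighted_comp \<psi> \<phi> (F (r k)) x - g x)) \<longlonglongrightarrow> 0"
    if F: "\<And>n. wnorm \<sigma>1 (F n) \<le> ennreal M'" for F M'
  proof -
    \<comment> \<open>The given bound \<open>M'\<close> may be negative, in which case
      \<open>ennreal M'\<close> is 0.\<close>
    define M where "M = max 0 M'"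
    have M0: "0 \<le> M" by (simp add: M_def)
    have "wnorm \<sigma>1 (F n) \<le> ennreal M" for n
      by (rule order_trans[OF F]) (simp add: M_def ennreal_leI)
    then have M: "\<sigma>1 x * cmod (F n x) \<le> M" for n x
      by (simp add: wnorm_le_ennreal_iff[OF M0])
    obtain r f where r: "strict_mono (r :: nat \<Rightarrow> nat)" and f: "\<And>x. \<sigma>1 x * cmod (f x) \<le> M"
      and ptw: "\<And>x. (\<lambda>n. F (r n) x) \<longlonglongrightarrow> f x"
      by (rule bounded_pointwise_convergent_subsequence[where F = F, OF countable M]) (rule that)
    have "\<sigma>1 x * cmod (F (r n) x - f x) \<le> 2 * M" for n x
    proof -
      have "\<sigma>1 x * cmod (F (r n) x - f x) \<le> \<sigma>1 x * (cmod (F (r n) x) + cmod (f x))"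
        using weight_pos(1)[of x] norm_triangle_ineq4 by (intro mult_left_mono) auto
      also have "\<dots> \<le> 2 * M"
        using M[of x "r n"] f[of x] by (simp add: distrib_left)
      finally show ?thesis .
    qed
    moreover have "(\<lambda>n. \<sigma>1 x * cmod (F (r n) x - f x)) \<longlonglongrightarrow> 0" for x
      using tendsto_norm_zero[OF LIM_zero[OF ptw[of x]]] by (rule tendsto_mult_right_zero)
    ultimately have "(\<lambda>k. wnorm \<sigma>2 (weighted_comp \<psi> \<phi> (\<lambda>x. F (r k) x - f x))) \<longlonglongrightarrow> 0"
      by (intro weighted_comp_wnorm_tendsto[OF C lim])
    then have "(\<lambda>k. wnorm \<sigma>2 (\<lambda>x. weighted_comp \<psi> \<phi> (F (r k)) x - weighted_comp \<psi> \<phi> f x))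
        \<longlonglongrightarrow> 0"
      by (simp add: weighted_comp_def right_diff_distrib)
    moreover have "weighted_comp \<psi> \<phi> f \<in> wspace \<sigma>2"
      using f M0 by (intro weighted_comp_in_wspace[OF C] wspaceI)
    ultimately show ?thesis using r by (intro bexI exI conjI)
  qed
  show ?thesis
    unfolding compact_operator_def
  proof (intro conjI ballI allI impI)
    show "weighted_comp \<psi> \<phi> f \<in> wspace \<sigma>2" if "f \<in> wspace \<sigma>1" for f
      using C that by (rule weighted_comp_in_wspace)
  qed (elim conjE exE, rule subseq, erule spec)
qed

end

theorem theorem9:
  fixes E :: "'v \<Rightarrow> 'v \<Rightarrow> bool" and \<rho> :: 'v
    and \<sigma>1 \<sigma>2 :: "'v \<Rightarrow> real" and \<phi> :: "'v \<Rightarrow> 'v" and \<psi> :: "'v \<Rightarrow> complex"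
  assumes "infinite_rooted_tree E \<rho>"
    and "weight \<sigma>1" and "weight \<sigma>2"
  shows "compact_operator \<sigma>1 \<sigma>2 (weighted_comp \<psi> \<phi>) \<longleftrightarrow>
    (\<forall>y. fiber_sup \<sigma>1 \<sigma>2 \<psi> \<phi> y < \<infinity>) \<and>
    (fiber_sup \<sigma>1 \<sigma>2 \<psi> \<phi> \<longlongrightarrow> 0) (at_infinity_from E \<rho>)"
proof -
  interpret infinite_rooted_tree E \<rho> by fact
  show ?thesis
    unfolding at_infinity_from_eq_cofinite
  proof (intro iffI conjI allI; (elim conjE)?)
    assume compact: "compact_operator \<sigma>1 \<sigma>2 (weighted_comp \<psi> \<phi>)"
    \<comment> \<open>The mapping half of compactness yields finiteness of the fiber suprema; the
      subsequence half yields the limit.\<close>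
    then have "\<forall>f\<in>wspace \<sigma>1. weighted_comp \<psi> \<phi> f \<in> wspace \<sigma>2"
      unfolding compact_operator_def by (rule conjunct1)
    then show "fiber_sup \<sigma>1 \<sigma>2 \<psi> \<phi> y < \<infinity>" for y
      by (rule fiber_sup_finite[OF assms(2,3)])
    show "(fiber_sup \<sigma>1 \<sigma>2 \<psi> \<phi> \<longlongrightarrow> 0) cofinite"
      by (rule compact_imp_fiber_sup_tendsto[OF assms(2,3) compact])
  next
    assume fin: "\<forall>y. fiber_sup \<sigma>1 \<sigma>2 \<psi> \<phi> y < \<infinity>"
      and lim: "(fiber_sup \<sigma>1 \<sigma>2 \<psi> \<phi> \<longlongrightarrow> 0) cofinite"
    show "compact_operator \<sigma>1 \<sigma>2 (weighted_comp \<psi> \<phi>)"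
      by (rule fiber_sup_tendsto_imp_compact[OF assms(2,3) countable_vertices fin[rule_format] lim])
  qed
qed

end
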